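(* Let $Q\subset E$ be convex, $f:Q\to\mathbb{R}$ convex with a minimizer $x_*\in Q$, $\delta,\widetilde\delta\ge0$, $L,\mu>0$. Suppose that for every $y\in Q$, $\psi_\delta(\cdot,y)$ is a $(\delta,L)$-model of $f$ at $y$ with respect to $V[y](x)$, that $\psi_\delta(x,x_* )\ge0$ for all $x\in Q$, and that $f$ is left relatively $\mu$-strongly convex, i.e. for all $x,y\in Q$ $$\mu V[x](y)\le f(x)-f(y)-\psi_\delta(x,y).$$ Let $x_0\in Q$ with $V[x_0](x_* )\le R^2$, and let $\varepsilon>0$ be given. Then, using restarts of the adaptive gradient method described in the context, one obtains a point $\bar x_{N_p}$ (the output of the last restart) with $$V[\bar x_{N_p}](x_* )\le\varepsilon+\frac{2\widetilde\delta}\mu+\frac{4\delta}\mu ,$$ the total number of iterations of the gradient method not exceeding $$N=\left\lceil\log_2\frac{R^2}\varepsilon\right\rceil\cdot\left\lceil\frac{4L}\mu\right\rceil .$$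
   Context: $E$ is a finite-dimensional real vector space. $d$ is a convex differentiable function on $Q$ and $V[y](x)=d(x)-d(y)-\langle\nabla d(y),x-y\rangle$. Model. $\psi_\delta(x,y)$ is a $(\delta,L)$-model of $f$ at $y\in Q$ w.r.t. $V[y](x)$ if there is $f_\delta(y)\in[f(y)-\delta,f(y)]$ such that for all $x\in Q$ $$0\le f(x)-\bigl(f_\delta(y)+\psi_\delta(x,y)\bigr)\le L\,V[y](x)+\delta,$$ $\psi_\delta(x,y)$ is convex in $x\in Q$, and $\psi_\delta(x,x)=0$ for all $x\in Q$. Inexact minimizer. For convex $\Psi$ on $Q$ and $\widetilde\delta\ge0$, $\arg\min^{\widetilde\delta}_{x\in Q}\Psi(x)$ denotes some point $\widetilde x\in Q$ for which there exists $h\in\partial\Psi(\widetilde x)$ with $\langle h,x-\widetilde x\rangle\ge-\widetilde\delta$ for all $x\in Q$. Adaptive gradient method (one run of $M$ iterations from a starting point $x_0$ with initial guess $L_0\in(0,L]$). Put $\alpha_0=A_0=0$. For $k=0,\dots,M-1$: find the smallest integer $i_k\ge 0$ such that, with $L_{k+1}=2^{i_k-1}L_k$, $\alpha_{k+1}=1/L_{k+1}$, $A_{k+1}=A_k+\alpha_{k+1}$ and $x_{k+1}=\arg\min^{\widetilde\delta}_{x\in Q}L_{k+1}\bigl(V[x_k](x)+\alpha_{k+1}\psi_{\delta}(x,x_k)\bigr)$, one has $f_{\delta}(x_{k+1})\le f_{\delta}(x_k)+\psi_{\delta}(x_{k+1},x_k)+L_{k+1}V[x_k](x_{k+1})+\delta$.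 The output of the run is $\bar x_M=\frac1{A_M}\sum_{k=0}^{M-1}\alpha_{k+1}x_{k+1}$. Restarts. The first run starts at $x_0$; each subsequent run starts at the output of the previous run; $N_j$ is the number of iterations of the $j$-th run and $\bar x_{N_j}$ its output. *)

theory Defs
  imports "HOL-Analysis.Analysis"
begin

text \<open>
  The finite-dimensional space is a Euclidean space, and linear functionals (gradients, subgradients)
  are represented by vectors through the inner product. The functions \<open>d\<close>, \<open>f\<close>, \<open>f\<^sub>\<delta>\<close>, \<open>\<psi>\<close> are
  total, but only their values on \<open>Q\<close> are ever used.
\<close>

definition bregman :: "('a::euclidean_space \<Rightarrow> real) \<Rightarrow> ('a \<Rightarrow> 'a) \<Rightarrow> 'a \<Rightarrow> 'a \<Rightarrow> real" where
  "bregman d grad y x = d x - d y - grad y \<bullet> (x - y)"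

text \<open>
  \<open>fdy\<close> is the inexact value of \<open>f\<close> at \<open>y\<close> that witnesses the model property; it is a parameter since
  the gradient method uses it.
\<close>

definition is_model ::
  "'a::euclidean_space set \<Rightarrow> ('a \<Rightarrow> 'a \<Rightarrow> real) \<Rightarrow> ('a \<Rightarrow> real) \<Rightarrow> real \<Rightarrow> real \<Rightarrow> 'a \<Rightarrow> real
    \<Rightarrow> ('a \<Rightarrow> 'a \<Rightarrow> real) \<Rightarrow> bool" where
  "is_model Q V f \<delta> L y fdy \<psi> \<longleftrightarrow>
     f y - \<delta> \<le> fdy \<and> fdy \<le> f y \<and>
     (\<forall>x\<in>Q. 0 \<le> f x - (fdy + \<psi> x y) \<and> f x - (fdy + \<psi> x y) \<le> L * V y x + \<delta>) \<and>
     convex_on Q (\<lambda>x. \<psi> x y) \<and>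
     (\<forall>x\<in>Q. \<psi> x x = 0)"

definition left_rel_strongly_convex ::
  "'a::euclidean_space set \<Rightarrow> ('a \<Rightarrow> 'a \<Rightarrow> real) \<Rightarrow> ('a \<Rightarrow> real) \<Rightarrow> ('a \<Rightarrow> 'a \<Rightarrow> real) \<Rightarrow> real \<Rightarrow> bool" where
  "left_rel_strongly_convex Q V f \<psi> \<mu> \<longleftrightarrow>
     (\<forall>x\<in>Q. \<forall>y\<in>Q. \<mu> * V x y \<le> f x - f y - \<psi> x y)"

definition subdifferential :: "'a::euclidean_space set \<Rightarrow> ('a \<Rightarrow> real) \<Rightarrow> 'a \<Rightarrow> 'a set" where
  "subdifferential Q \<Psi> x = {h. \<forall>y\<in>Q. \<Psi> x + h \<bullet> (y - x) \<le> \<Psi> y}"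

definition is_inexact_argmin :: "'a::euclidean_space set \<Rightarrow> real \<Rightarrow> ('a \<Rightarrow> real) \<Rightarrow> 'a \<Rightarrow> bool" where
  "is_inexact_argmin Q \<delta>' \<Psi> z \<longleftrightarrow>
     z \<in> Q \<and> (\<exists>h\<in>subdifferential Q \<Psi> z. \<forall>x\<in>Q. h \<bullet> (x - z) \<ge> - \<delta>')"

definition step_objective ::
  "('a::euclidean_space \<Rightarrow> 'a \<Rightarrow> real) \<Rightarrow> ('a \<Rightarrow> 'a \<Rightarrow> real) \<Rightarrow> real \<Rightarrow> 'a \<Rightarrow> 'a \<Rightarrow> real" where
  "step_objective V \<psi> L' y x = L' * (V y x + (1 / L') * \<psi> x y)"

definition accepts ::
  "('a::euclidean_space \<Rightarrow> 'a \<Rightarrow> real) \<Rightarrow> ('a \<Rightarrow> 'a \<Rightarrow> real) \<Rightarrow> ('a \<Rightarrow> real) \<Rightarrow> real \<Rightarrow> real \<Rightarrow> 'a \<Rightarrow> 'a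
    \<Rightarrow> bool" where
  "accepts V \<psi> f\<^sub>\<delta> \<delta> L' y x' \<longleftrightarrow> f\<^sub>\<delta> x' \<le> f\<^sub>\<delta> y + \<psi> x' y + L' * V y x' + \<delta>"

text \<open>
  One iteration from \<open>y = x\<^sub>k\<close> with constant \<open>Lk\<close>, leading to \<open>x' = x\<^sub>k\<^sub>+\<^sub>1\<close> with constant
  \<open>L' = L\<^sub>k\<^sub>+\<^sub>1\<close>. Inexact minimizers are not unique, so the one computed for the trial constant \<open>\<Lambda>\<close> and
  the centre \<open>y\<close> is given by an oracle \<open>prox \<Lambda> y\<close>. All trial points have to be
  inexact minimizers, and the first acceptable trial is taken.
\<close>

definition agm_step ::
  "'a::euclidean_space set \<Rightarrow> ('a \<Rightarrow> 'a \<Rightarrow> real) \<Rightarrow> ('a \<Rightarrow> 'a \<Rightarrow> real) \<Rightarrow> ('a \<Rightarrow> real) \<Rightarrow> real \<Rightarrow> real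
    \<Rightarrow> (real \<Rightarrow> 'a \<Rightarrow> 'a) \<Rightarrow> real \<Rightarrow> 'a \<Rightarrow> real \<Rightarrow> 'a \<Rightarrow> bool" where
  "agm_step Q V \<psi> f\<^sub>\<delta> \<delta> \<delta>' prox Lk y L' x' \<longleftrightarrow>
     (let \<Lambda> = (\<lambda>m::nat. 2 powi (int m - 1) * Lk); z = (\<lambda>m. prox (\<Lambda> m) y) in
      \<exists>i. (\<forall>m\<le>i. is_inexact_argmin Q \<delta>' (step_objective V \<psi> (\<Lambda> m) y) (z m)) \<and>
          accepts V \<psi> f\<^sub>\<delta> \<delta> (\<Lambda> i) y (z i) \<and>
          (\<forall>m<i. \<not> accepts V \<psi> f\<^sub>\<delta> \<delta> (\<Lambda> m) y (z m)) \<and>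
          L' = \<Lambda> i \<and> x' = z i)"

text \<open>
  A run of \<open>M\<close> iterations from \<open>x0\<close> with initial guess \<open>L0\<close> and output \<open>out\<close>. The oracle may depend on
  the iteration index. Here \<open>\<alpha>\<^sub>k\<^sub>+\<^sub>1 = 1 / L\<^sub>k\<^sub>+\<^sub>1\<close> and \<open>A\<^sub>M\<close> is the sum of \<open>\<alpha>\<^sub>1, \<dots>, \<alpha>\<^sub>M\<close>.
\<close>

definition agm_run ::
  "'a::euclidean_space set \<Rightarrow> ('a \<Rightarrow> 'a \<Rightarrow> real) \<Rightarrow> ('a \<Rightarrow> 'a \<Rightarrow> real) \<Rightarrow> ('a \<Rightarrow> real) \<Rightarrow> real \<Rightarrow> real
    \<Rightarrow> (nat \<Rightarrow> real \<Rightarrow> 'a \<Rightarrow> 'a) \<Rightarrow> real \<Rightarrow> 'a \<Rightarrow> nat \<Rightarrow> 'a \<Rightarrow> bool" where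
  "agm_run Q V \<psi> f\<^sub>\<delta> \<delta> \<delta>' prox L0 x0 M out \<longleftrightarrow>
     (\<exists>Ls xs. Ls 0 = L0 \<and> xs 0 = x0 \<and>
        (\<forall>k<M. agm_step Q V \<psi> f\<^sub>\<delta> \<delta> \<delta>' (prox k) (Ls k) (xs k) (Ls (Suc k)) (xs (Suc k))) \<and>
        out = (1 / (\<Sum>k<M. 1 / Ls (Suc k))) *\<^sub>R (\<Sum>k<M. (1 / Ls (Suc k)) *\<^sub>R xs (Suc k)))"

text \<open>
  \<open>p\<close> successive runs: run \<open>j\<close> (counted from 0) starts at \<open>xs j\<close>, uses the initial guess \<open>L0 j\<close>, makes
  \<open>Ns j\<close> iterations and outputs \<open>xs (j + 1)\<close>, so \<open>xs p\<close> is the output of the last run. Given \<open>prox\<close>,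
  the points \<open>xs 0, \<dots>, xs p\<close> are uniquely determined.
\<close>

definition restarted_agm ::
  "'a::euclidean_space set \<Rightarrow> ('a \<Rightarrow> 'a \<Rightarrow> real) \<Rightarrow> ('a \<Rightarrow> 'a \<Rightarrow> real) \<Rightarrow> ('a \<Rightarrow> real) \<Rightarrow> real \<Rightarrow> real
    \<Rightarrow> (nat \<Rightarrow> nat \<Rightarrow> real \<Rightarrow> 'a \<Rightarrow> 'a) \<Rightarrow> (nat \<Rightarrow> real) \<Rightarrow> 'a \<Rightarrow> nat \<Rightarrow> (nat \<Rightarrow> nat) \<Rightarrow> (nat \<Rightarrow> 'a)
    \<Rightarrow> bool" where
  "restarted_agm Q V \<psi> f\<^sub>\<delta> \<delta> \<delta>' prox L0 x0 p Ns xs \<longleftrightarrow>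
     xs 0 = x0 \<and>
     (\<forall>j<p. agm_run Q V \<psi> f\<^sub>\<delta> \<delta> \<delta>' (prox j) (L0 j) (xs j) (Ns j) (xs (Suc j)))"

text \<open>
  An oracle that succeeds on every auxiliary problem. Such an oracle need not exist (e.g. for
  \<open>\<delta>' = 0\<close> and \<open>Q\<close> not closed), in which case the method may break down.
\<close>

definition total_oracle ::
  "'a::euclidean_space set \<Rightarrow> ('a \<Rightarrow> 'a \<Rightarrow> real) \<Rightarrow> ('a \<Rightarrow> 'a \<Rightarrow> real) \<Rightarrow> real
    \<Rightarrow> (nat \<Rightarrow> nat \<Rightarrow> real \<Rightarrow> 'a \<Rightarrow> 'a) \<Rightarrow> bool" where
  "total_oracle Q V \<psi> \<delta>' prox \<longleftrightarrow>
     (\<forall>j k. \<forall>\<Lambda>>0. \<forall>y\<in>Q. is_inexact_argmin Q \<delta>' (step_objective V \<psi> \<Lambda> y) (prox j k \<Lambda> y))"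

end

theory Submission
  imports Defs
begin

text \<open>
  For an accepted step from \<open>y\<close> to \<open>x'\<close> with constant \<open>L'\<close>, the optimality condition of the auxiliary
  problem, the three-point identity of the Bregman divergence and the model inequalities give
  \<open>f x' - f x\<^sub>* \<le> L' (V y x\<^sub>* - V x' x\<^sub>*) + \<delta>' + 2 \<delta>\<close>. After division by \<open>L'\<close> this telescopes along a run,
  and convexity of \<open>f\<close> turns it into a bound at the averaged point. Since the constants never exceed
  \<open>2 L\<close>, left relative strong convexity at \<open>x\<^sub>*\<close> yields
  \<open>V out x\<^sub>* \<le> 2 L / (\<mu> M) V start x\<^sub>* + (\<delta>' + 2 \<delta>) / \<mu>\<close> for a run of \<open>M\<close> iterations. With
  \<open>M \<ge> 4 L / \<mu>\<close> each run halves the distance up to an additive error, and these errors sum up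
  geometrically to at most \<open>2 (\<delta>' + 2 \<delta>) / \<mu>\<close>.
\<close>

section \<open>Directional derivatives and Bregman divergences on a convex set\<close>

text \<open>Convexity keeps the segment from \<open>z\<close> to \<open>x\<close> inside
  \<open>Q\<close>, so the derivative within \<open>Q\<close> composes with its parametrization on
  \<open>{0..1}\<close>. The limit is one-sided since \<open>z\<close> may lie on the boundary of
  \<open>Q\<close>.\<close>

lemma has_derivative_within_convex_right_limit:
  fixes d :: "'a::euclidean_space \<Rightarrow> real"
  assumes "convex Q" "x \<in> Q" "z \<in> Q"
    and "(d has_derivative (\<lambda>h. g \<bullet> h)) (at z within Q)"
  shows "((\<lambda>t. (d (z + t *\<^sub>R (x - z)) - d z) / t) \<longlongrightarrow> g \<bullet> (x - z)) (at_right 0)"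
proof -
  let ?p = "\<lambda>t::real. z + t *\<^sub>R (x - z)"
  have img: "?p ` {0..1} \<subseteq> Q"
  proof safe
    fix t :: real assume "t \<in> {0..1}"
    then have "(1 - t) *\<^sub>R z + t *\<^sub>R x \<in> Q"
      using assms by (intro convexD) auto
    then show "?p t \<in> Q" by (simp add: algebra_simps)
  qed
  have "(?p has_derivative (\<lambda>t. t *\<^sub>R (x - z))) (at 0 within {0..1})"
    by (auto intro!: derivative_eq_intros)
  moreover have "(d has_derivative (\<lambda>h. g \<bullet> h)) (at (?p 0) within ?p ` {0..1})"
    using has_derivative_subset[OF assms(4) img] by simp
  ultimately have "((\<lambda>t. d (?p t)) has_derivative (\<lambda>t. g \<bullet> (t *\<^sub>R (x - z)))) (at 0 within {0..1})"
    by (rule has_derivative_in_compose)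
  then have "((\<lambda>t. d (?p t)) has_field_derivative g \<bullet> (x - z)) (at 0 within {0..1})"
    by (simp add: has_field_derivative_def mult_commute_abs)
  then show ?thesis
    by (simp add: has_field_derivative_iff at_within_Icc_at_right)
qed

text \<open>Convexity bounds every difference quotient along the segment from \<open>y\<close> to
  \<open>x\<close> by \<open>d x - d y\<close>, and the bound passes to the limit.\<close>

lemma bregman_nonneg:
  assumes "convex Q" "convex_on Q d" "x \<in> Q" "y \<in> Q"
    and "(d has_derivative (\<lambda>h. grad y \<bullet> h)) (at y within Q)"
  shows "0 \<le> bregman d grad y x"
proof -
  have "(d (y + t *\<^sub>R (x - y)) - d y) / t \<le> d x - d y" if "t \<in> {0<..<1}" for t :: real
  proof -
    have "d ((1 - t) *\<^sub>R y + t *\<^sub>R x) \<le> (1 - t) * d y + t * d x"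
      using assms that by (intro convex_onD) auto
    then have "d (y + t *\<^sub>R (x - y)) - d y \<le> (d x - d y) * t"
      by (simp add: algebra_simps)
    then show ?thesis using that by (simp add: pos_divide_le_eq)
  qed
  then have "\<forall>\<^sub>F t in at_right 0. (d (y + t *\<^sub>R (x - y)) - d y) / t \<le> d x - d y"
    using eventually_at_right_real[of 0 "1::real"] by (auto elim: eventually_mono)
  then have "grad y \<bullet> (x - y) \<le> d x - d y"
    using assms by (intro tendsto_upperbound[OF has_derivative_within_convex_right_limit]) auto
  then show ?thesis by (simp add: bregman_def)
qed

text \<open>
  The limit along the segment from \<open>z\<close> to \<open>x\<close> replaces the sum rule for subdifferentials.
\<close>

lemma inexact_argmin_three_point:
  assumes "convex Q" "x \<in> Q" "L' > 0"
    and "convex_on Q (\<lambda>u. \<psi> u y)"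
    and argmin: "is_inexact_argmin Q \<delta>' (step_objective (bregman d grad) \<psi> L' y) z"
    and deriv: "(d has_derivative (\<lambda>h. grad z \<bullet> h)) (at z within Q)"
  shows "\<psi> z y + L' * bregman d grad y z + L' * bregman d grad z x
           \<le> \<psi> x y + L' * bregman d grad y x + \<delta>'"
proof -
  let ?\<Psi> = "step_objective (bregman d grad) \<psi> L' y"
  \<comment> \<open>Solving the claimed inequality for \<open>grad z \<bullet> (x - z)\<close>
    leaves exactly \<open>?c\<close> as its lower bound.\<close>
  let ?c = "grad y \<bullet> (x - z) - (\<psi> x y - \<psi> z y + \<delta>') / L'"
  obtain h where z: "z \<in> Q" and h: "\<And>u. u \<in> Q \<Longrightarrow> ?\<Psi> z + h \<bullet> (u - z) \<le> ?\<Psi> u"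
    and hx: "h \<bullet> (x - z) \<ge> - \<delta>'"
    using argmin \<open>x \<in> Q\<close> by (auto simp: is_inexact_argmin_def subdifferential_def)
  have \<Psi>: "?\<Psi> u = L' * (d u - d y - grad y \<bullet> (u - y)) + \<psi> u y" for u
    using \<open>L' > 0\<close> by (simp add: step_objective_def bregman_def field_simps)
  \<comment> \<open>The subgradient inequality is tested at the segment point \<open>?u\<close>.
    Convexity of \<open>\<psi>\<close> bounds its increment linearly in \<open>t\<close>, so
    division by \<open>t * L'\<close> isolates the difference quotient of \<open>d\<close>.\<close>
  have "?c \<le> (d (z + t *\<^sub>R (x - z)) - d z) / t" if t: "t \<in> {0<..<1}" for t :: real
  proof -
    let ?u = "z + t *\<^sub>R (x - z)"
    have u: "?u = (1 - t) *\<^sub>R z + t *\<^sub>R x" by (simp add: algebra_simps)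
    have "?u \<in> Q" unfolding u using assms z t by (intro convexD) auto
    have "\<psi> ?u y \<le> (1 - t) * \<psi> z y + t * \<psi> x y"
      unfolding u using assms z t by (intro convex_onD[of Q "\<lambda>u. \<psi> u y"]) auto
    moreover have "t * - \<delta>' \<le> t * (h \<bullet> (x - z))"
      using hx t by (intro mult_left_mono) auto
    moreover have "?\<Psi> z + t * (h \<bullet> (x - z)) \<le> ?\<Psi> ?u"
      using h[OF \<open>?u \<in> Q\<close>] by simp
    ultimately have "t * (L' * (grad y \<bullet> (x - z)) - (\<psi> x y - \<psi> z y + \<delta>')) \<le> L' * (d ?u - d z)"
      by (simp add: \<Psi> algebra_simps)
    then show ?thesis using t \<open>L' > 0\<close> by (simp add: field_simps)
  qed
  then have "\<forall>\<^sub>F t in at_right 0. ?c \<le> (d (z + t *\<^sub>R (x - z)) - d z) / t"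
    using eventually_at_right_real[of 0 "1::real"] by (auto elim: eventually_mono)
  then have "?c \<le> grad z \<bullet> (x - z)"
    using assms z by (intro tendsto_lowerbound[OF has_derivative_within_convex_right_limit]) auto
  then have "L' * (grad y \<bullet> (x - z)) - (\<psi> x y - \<psi> z y + \<delta>') \<le> L' * (grad z \<bullet> (x - z))"
    using \<open>L' > 0\<close> by (simp add: field_simps)
  then show ?thesis
    by (simp add: bregman_def algebra_simps)
qed

section \<open>One step and one run of the adaptive method\<close>

locale relative_model =
  fixes Q :: "'a::euclidean_space set"
    and d f f\<^sub>\<delta> :: "'a \<Rightarrow> real" and grad :: "'a \<Rightarrow> 'a" and \<psi> V :: "'a \<Rightarrow> 'a \<Rightarrow> real"
    and \<delta> \<delta>' L :: real
  assumes convex_Q: "convex Q"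
    and convex_d: "convex_on Q d"
    and deriv_d: "\<And>y. y \<in> Q \<Longrightarrow> (d has_derivative (\<lambda>h. grad y \<bullet> h)) (at y within Q)"
    and V_def: "V = bregman d grad"
    and convex_f: "convex_on Q f"
    and L_pos: "L > 0"
    and model: "\<And>y. y \<in> Q \<Longrightarrow> is_model Q V f \<delta> L y (f\<^sub>\<delta> y) \<psi>"
begin

lemma V_nonneg: "x \<in> Q \<Longrightarrow> y \<in> Q \<Longrightarrow> 0 \<le> V y x"
  unfolding V_def using convex_Q convex_d deriv_d by (intro bregman_nonneg) auto

text \<open>The upper model inequality is the acceptance test for the constant \<open>L\<close>, up
  to \<open>f\<^sub>\<delta> x \<le> f x\<close>; a larger constant only weakens the test because
  \<open>V\<close> is nonnegative. This both ends the search for a step and limits its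
  constant.\<close>

lemma accepts_if_ge:
  assumes "x \<in> Q" "y \<in> Q" "L \<le> \<Lambda>"
  shows "accepts V \<psi> f\<^sub>\<delta> \<delta> \<Lambda> y x"
proof -
  have "L * V y x \<le> \<Lambda> * V y x"
    using assms V_nonneg by (intro mult_right_mono) auto
  moreover have "f\<^sub>\<delta> x \<le> f x" "f x - (f\<^sub>\<delta> y + \<psi> x y) \<le> L * V y x + \<delta>"
    using assms model by (auto simp: is_model_def)
  ultimately show ?thesis by (simp add: accepts_def)
qed

text \<open>These are the invariants of a run. The first trial halves \<open>Lk\<close>; a later
  accepted constant is twice a rejected one, and rejected constants lie below
  \<open>L\<close>.\<close>

lemma agm_step_bounds:
  assumes "agm_step Q V \<psi> f\<^sub>\<delta> \<delta> \<delta>' prox Lk y L' x'" "y \<in> Q" "0 < Lk" "Lk \<le> 2 * L"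
  shows "x' \<in> Q" "0 < L'" "L' \<le> 2 * L"
proof -
  define \<Lambda> where "\<Lambda> m = 2 powi (int m - 1) * Lk" for m :: nat
  obtain i where argmin: "\<And>m. m \<le> i \<Longrightarrow>
        is_inexact_argmin Q \<delta>' (step_objective V \<psi> (\<Lambda> m) y) (prox (\<Lambda> m) y)"
    and rej: "\<And>m. m < i \<Longrightarrow> \<not> accepts V \<psi> f\<^sub>\<delta> \<delta> (\<Lambda> m) y (prox (\<Lambda> m) y)"
    and L': "L' = \<Lambda> i" and x': "x' = prox (\<Lambda> i) y"
    using assms(1) unfolding agm_step_def Let_def \<Lambda>_def by blast
  show "x' \<in> Q" using argmin[of i] x' by (simp add: is_inexact_argmin_def)
  show "0 < L'" using assms by (simp add: L' \<Lambda>_def)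
  show "L' \<le> 2 * L"
  proof (cases i)
    case 0
    then show ?thesis using assms by (simp add: L' \<Lambda>_def power_int_minus)
  next
    case (Suc m)
    have "prox (\<Lambda> m) y \<in> Q" using argmin[of m] Suc by (simp add: is_inexact_argmin_def)
    then have "\<Lambda> m < L" using rej[of m] accepts_if_ge[of _ y "\<Lambda> m"] Suc assms by force
    moreover have "\<Lambda> i = 2 * \<Lambda> m" by (simp add: \<Lambda>_def Suc power_int_diff)
    ultimately show ?thesis using L' by simp
  qed
qed

text \<open>One \<open>\<delta>\<close> comes from the acceptance test and one from replacing
  \<open>f\<^sub>\<delta> x'\<close> by \<open>f x'\<close>; the lower model inequality at
  \<open>x\<close> absorbs \<open>\<psi> x y\<close>. Dividing by \<open>L'\<close> frees the
  divergences of the varying constant, so that they telescope.\<close>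

lemma agm_step_decrease:
  assumes step: "agm_step Q V \<psi> f\<^sub>\<delta> \<delta> \<delta>' prox Lk y L' x'" and "y \<in> Q" "0 < Lk" "x \<in> Q"
  shows "(f x' - f x) / L' \<le> V y x - V x' x + (\<delta>' + 2 * \<delta>) / L'"
proof -
  have "0 < L'" using assms by (auto simp: agm_step_def Let_def)
  have argmin: "is_inexact_argmin Q \<delta>' (step_objective V \<psi> L' y) x'"
    and acc: "accepts V \<psi> f\<^sub>\<delta> \<delta> L' y x'"
    using step unfolding agm_step_def Let_def by blast+
  have "x' \<in> Q" using argmin by (simp add: is_inexact_argmin_def)
  have "convex_on Q (\<lambda>u. \<psi> u y)" using model[OF \<open>y \<in> Q\<close>] by (simp add: is_model_def)
  then have "\<psi> x' y + L' * V y x' + L' * V x' x \<le> \<psi> x y + L' * V y x + \<delta>'"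
    unfolding V_def
    using convex_Q \<open>x \<in> Q\<close> \<open>x' \<in> Q\<close> \<open>0 < L'\<close> argmin[unfolded V_def] deriv_d
    by (intro inexact_argmin_three_point) auto
  moreover have "f x' - \<delta> \<le> f\<^sub>\<delta> x'" "0 \<le> f x - (f\<^sub>\<delta> y + \<psi> x y)"
    using model \<open>x' \<in> Q\<close> \<open>y \<in> Q\<close> \<open>x \<in> Q\<close> by (auto simp: is_model_def)
  ultimately have "f x' - f x \<le> L' * (V y x - V x' x) + (\<delta>' + 2 * \<delta>)"
    using acc by (simp add: accepts_def algebra_simps)
  then have "(f x' - f x) / L' \<le> (L' * (V y x - V x' x) + (\<delta>' + 2 * \<delta>)) / L'"
    using \<open>0 < L'\<close> by (intro divide_right_mono) auto
  then show ?thesis using \<open>0 < L'\<close> by (simp add: add_divide_distrib)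
qed

text \<open>The step inequalities are summed with weights \<open>1 / Ls (Suc k)\<close>, each at
  least \<open>1 / (2 * L)\<close>. Their sum is therefore at least \<open>M / (2 * L)\<close>,
  which gives the rate.\<close>

lemma agm_run_bound:
  assumes run: "agm_run Q V \<psi> f\<^sub>\<delta> \<delta> \<delta>' prox L0 x0 M out"
    and "x0 \<in> Q" "0 < L0" "L0 \<le> 2 * L" "1 \<le> M" "x \<in> Q"
  shows "out \<in> Q" "f out - f x \<le> 2 * L * V x0 x / M + (\<delta>' + 2 * \<delta>)"
proof -
  obtain Ls xs where init: "Ls 0 = L0" "xs 0 = x0"
    and step: "\<And>k. k < M \<Longrightarrow> agm_step Q V \<psi> f\<^sub>\<delta> \<delta> \<delta>' (prox k) (Ls k) (xs k) (Ls (Suc k)) (xs (Suc k))"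
    and out: "out = (1 / (\<Sum>k<M. 1 / Ls (Suc k))) *\<^sub>R (\<Sum>k<M. (1 / Ls (Suc k)) *\<^sub>R xs (Suc k))"
    using run unfolding agm_run_def by blast
  have inv: "xs k \<in> Q \<and> 0 < Ls k \<and> Ls k \<le> 2 * L" if "k \<le> M" for k
    using that
  proof (induction k)
    case 0
    then show ?case using init assms by simp
  next
    case (Suc k)
    then show ?case using agm_step_bounds[OF step[of k]] by simp
  qed
  define \<alpha> where "\<alpha> k = 1 / Ls (Suc k)" for k
  define A where "A = (\<Sum>k<M. \<alpha> k)"
  \<comment> \<open>Normalized weights exhibit \<open>out\<close> as a convex combination of the
    iterates, so that Jensen's inequality applies. Positivity of \<open>A\<close> rests on
    \<open>1 \<le> M\<close>.\<close>
  define w where "w k = \<alpha> k / A" for k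
  have \<alpha>: "1 / (2 * L) \<le> \<alpha> k" if "k < M" for k
    unfolding \<alpha>_def using inv[of "Suc k"] that by (intro divide_left_mono) auto
  have "(\<Sum>k<M. 1 / (2 * L)) \<le> A"
    unfolding A_def by (intro sum_mono \<alpha>) auto
  then have A_ge: "M / (2 * L) \<le> A" by simp
  moreover have "0 < M / (2 * L)" using L_pos \<open>1 \<le> M\<close> by simp
  ultimately have "0 < A" by linarith
  have w: "(\<Sum>k<M. w k) = 1" "\<And>k. k < M \<Longrightarrow> 0 \<le> w k"
  proof -
    show "(\<Sum>k<M. w k) = 1"
      using \<open>0 < A\<close> by (simp add: w_def A_def flip: sum_divide_distrib)
    show "0 \<le> w k" if "k < M" for k
      using inv[of "Suc k"] that \<open>0 < A\<close> by (simp add: w_def \<alpha>_def)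
  qed
  have out_w: "out = (\<Sum>k<M. w k *\<^sub>R xs (Suc k))"
    by (simp add: out w_def A_def \<alpha>_def scaleR_sum_right mult.commute)
  have in_Q: "xs (Suc k) \<in> Q" if "k < M" for k using inv[of "Suc k"] that by simp
  show "out \<in> Q"
    unfolding out_w using w in_Q convex_Q by (intro convex_sum) auto
  have "f out \<le> (\<Sum>k<M. w k * f (xs (Suc k)))"
    unfolding out_w using convex_f w in_Q \<open>1 \<le> M\<close> by (intro convex_on_sum) (auto simp: lessThan_empty_iff)
  then have "A * f out \<le> (\<Sum>k<M. \<alpha> k * f (xs (Suc k)))"
    using \<open>0 < A\<close> by (simp add: w_def field_simps flip: sum_divide_distrib)
  then have "A * (f out - f x) \<le> (\<Sum>k<M. \<alpha> k * f (xs (Suc k))) - A * f x"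
    by (simp add: right_diff_distrib)
  also have "\<dots> = (\<Sum>k<M. \<alpha> k * (f (xs (Suc k)) - f x))"
    by (simp add: A_def right_diff_distrib sum_subtractf sum_distrib_right)
  also have "\<dots> \<le> (\<Sum>k<M. (V (xs k) x - V (xs (Suc k)) x) + \<alpha> k * (\<delta>' + 2 * \<delta>))"
  proof (rule sum_mono)
    fix k assume "k \<in> {..<M}"
    then show "\<alpha> k * (f (xs (Suc k)) - f x) \<le> V (xs k) x - V (xs (Suc k)) x + \<alpha> k * (\<delta>' + 2 * \<delta>)"
      using agm_step_decrease[OF step[of k]] inv[of k] \<open>x \<in> Q\<close> by (simp add: \<alpha>_def)
  qed
  also have "\<dots> = V x0 x - V (xs M) x + A * (\<delta>' + 2 * \<delta>)"
    using sum_lessThan_telescope'[of "\<lambda>k. V (xs k) x" M]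
    by (simp add: sum.distrib A_def sum_distrib_right init)
  also have "\<dots> \<le> V x0 x + A * (\<delta>' + 2 * \<delta>)"
    using V_nonneg[of x "xs M"] inv[of M] \<open>x \<in> Q\<close> by simp
  finally have "f out - f x \<le> V x0 x / A + (\<delta>' + 2 * \<delta>)"
    using \<open>0 < A\<close> by (simp add: field_simps)
  also have "V x0 x / A \<le> V x0 x / (M / (2 * L))"
    using A_ge \<open>0 < M / (2 * L)\<close> \<open>0 < A\<close> V_nonneg[of x x0] assms by (intro divide_left_mono) auto
  finally show "f out - f x \<le> 2 * L * V x0 x / M + (\<delta>' + 2 * \<delta>)"
    by (simp add: mult.commute)
qed

section \<open>Existence of steps, runs and restarts under a total oracle\<close>

text \<open>The trial constants double, so one of them reaches \<open>L\<close> and is accepted; the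
  least accepted index is the one the method takes.\<close>

lemma agm_step_exists:
  assumes "y \<in> Q" "0 < Lk"
    and argmins: "\<And>\<Lambda>. 0 < \<Lambda> \<Longrightarrow> is_inexact_argmin Q \<delta>' (step_objective V \<psi> \<Lambda> y) (prox \<Lambda> y)"
  shows "\<exists>L' x'. agm_step Q V \<psi> f\<^sub>\<delta> \<delta> \<delta>' prox Lk y L' x'"
proof -
  define \<Lambda> where "\<Lambda> m = 2 powi (int m - 1) * Lk" for m :: nat
  define acc where "acc m \<longleftrightarrow> accepts V \<psi> f\<^sub>\<delta> \<delta> (\<Lambda> m) y (prox (\<Lambda> m) y)" for m
  have \<Lambda>_pos: "0 < \<Lambda> m" for m using assms by (simp add: \<Lambda>_def)
  \<comment> \<open>The factor 2 compensates for the exponent \<open>m - 1\<close> in the trial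
    constant.\<close>
  obtain m where "2 * L / Lk < 2 ^ m"
    using real_arch_pow[of 2 "2 * L / Lk"] by auto
  then have "L \<le> \<Lambda> m"
    using assms by (simp add: \<Lambda>_def power_int_diff field_simps)
  then have "acc m"
    unfolding acc_def using argmins[OF \<Lambda>_pos] assms
    by (intro accepts_if_ge) (auto simp: is_inexact_argmin_def)
  then have "acc (LEAST m. acc m)" "\<forall>m < (LEAST m. acc m). \<not> acc m"
    by (auto intro: LeastI dest: not_less_Least)
  then show ?thesis
    unfolding agm_step_def Let_def acc_def \<Lambda>_def
    using argmins[OF \<Lambda>_pos, unfolded \<Lambda>_def] by blast
qed

lemma agm_run_exists:
  assumes "x0 \<in> Q" "0 < L0" "L0 \<le> 2 * L"
    and argmins: "\<And>k \<Lambda> y. 0 < \<Lambda> \<Longrightarrow> y \<in> Q \<Longrightarrow>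
           is_inexact_argmin Q \<delta>' (step_objective V \<psi> \<Lambda> y) (prox k \<Lambda> y)"
  shows "\<exists>out. agm_run Q V \<psi> f\<^sub>\<delta> \<delta> \<delta>' prox L0 x0 M out"
proof -
  \<comment> \<open>The state pairs the current constant with the current point; \<open>P\<close> is
    what the next step requires.\<close>
  define P where "P s \<longleftrightarrow> snd s \<in> Q \<and> 0 < fst s \<and> fst s \<le> 2 * L" for s :: "real \<times> 'a"
  have step: "\<exists>t. P t \<and> agm_step Q V \<psi> f\<^sub>\<delta> \<delta> \<delta>' (prox k) (fst s) (snd s) (fst t) (snd t)"
    if "P s" for s k
  proof -
    have s: "snd s \<in> Q" "0 < fst s" "fst s \<le> 2 * L" using that by (auto simp: P_def)
    obtain L' x' where st: "agm_step Q V \<psi> f\<^sub>\<delta> \<delta> \<delta>' (prox k) (fst s) (snd s) L' x'"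
      using agm_step_exists[of "snd s" "fst s" "prox k"] s argmins by blast
    then have "P (L', x')" using agm_step_bounds[OF st s] by (simp add: P_def)
    then show ?thesis using st by (intro exI[of _ "(L', x')"]) simp
  qed
  have "P (L0, x0)" using assms by (simp add: P_def)
  \<comment> \<open>The clause for \<open>n = 0\<close> pins the initial state. The choice yields an
    infinite sequence, of which a run uses the first \<open>M\<close> steps.\<close>
  then obtain s where s0: "s 0 = (L0, x0)"
    and s: "\<And>k. agm_step Q V \<psi> f\<^sub>\<delta> \<delta> \<delta>' (prox k) (fst (s k)) (snd (s k)) (fst (s (Suc k))) (snd (s (Suc k)))"
    using dependent_nat_choice[of "\<lambda>n t. P t \<and> (n = 0 \<longrightarrow> t = (L0, x0))"
        "\<lambda>k s t. agm_step Q V \<psi> f\<^sub>\<delta> \<delta> \<delta>' (prox k) (fst s) (snd s) (fst t) (snd t)"]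
      step by blast
  show ?thesis
    unfolding agm_run_def
    using s0 s by (intro exI[of _ "fst \<circ> s"] exI[of _ "snd \<circ> s"] exI) auto
qed

text \<open>Outputs are picked by dependent choice. Positive run lengths keep them in
  \<open>Q\<close>, whereas an empty run would output the zero vector.\<close>

lemma restarted_agm_exists:
  assumes "x0 \<in> Q" "\<And>j. 0 < L0 j \<and> L0 j \<le> 2 * L" "\<And>j. j < p \<Longrightarrow> 1 \<le> Ns j"
    and argmins: "total_oracle Q V \<psi> \<delta>' prox"
  shows "\<exists>xs. restarted_agm Q V \<psi> f\<^sub>\<delta> \<delta> \<delta>' prox L0 x0 p Ns xs"
proof -
  \<comment> \<open>The guard \<open>j < p\<close> lets the sequence continue with any point of
    \<open>Q\<close> after the last run.\<close>
  have "\<exists>z. z \<in> Q \<and> (j < p \<longrightarrow> agm_run Q V \<psi> f\<^sub>\<delta> \<delta> \<delta>' (prox j) (L0 j) y (Ns j) z)"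
    if "y \<in> Q" for y j
  proof (cases "j < p")
    case True
    obtain z where "agm_run Q V \<psi> f\<^sub>\<delta> \<delta> \<delta>' (prox j) (L0 j) y (Ns j) z"
      using agm_run_exists[of y "L0 j" "prox j" "Ns j"] assms \<open>y \<in> Q\<close>
      by (auto simp: total_oracle_def)
    then show ?thesis using agm_run_bound(1) that assms True by blast
  qed (use that in auto)
  then obtain xs where "xs 0 = x0"
    and "\<And>j. j < p \<longrightarrow> agm_run Q V \<psi> f\<^sub>\<delta> \<delta> \<delta>' (prox j) (L0 j) (xs j) (Ns j) (xs (Suc j))"
    using dependent_nat_choice[of "\<lambda>n y. y \<in> Q \<and> (n = 0 \<longrightarrow> y = x0)"
        "\<lambda>j y z. j < p \<longrightarrow> agm_run Q V \<psi> f\<^sub>\<delta> \<delta> \<delta>' (prox j) (L0 j) y (Ns j) z"] assms(1)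
    by auto
  then show ?thesis by (auto simp: restarted_agm_def)
qed

section \<open>Contraction of the distance to the minimizer over restarts\<close>

lemma agm_run_contraction:
  assumes run: "agm_run Q V \<psi> f\<^sub>\<delta> \<delta> \<delta>' prox L0 x0 M out"
    and "x0 \<in> Q" "0 < L0" "L0 \<le> 2 * L" "xstar \<in> Q"
    and "0 < \<mu>" "4 * L / \<mu> \<le> M"
    and "\<And>x. x \<in> Q \<Longrightarrow> \<psi> x xstar \<ge> 0"
    and "left_rel_strongly_convex Q V f \<psi> \<mu>"
  shows "out \<in> Q" "V out xstar \<le> V x0 xstar / 2 + (\<delta>' + 2 * \<delta>) / \<mu>"
proof -
  have "0 < 4 * L / \<mu>" using L_pos \<open>0 < \<mu>\<close> by simp
  then have M: "1 \<le> M" "0 < real M" using \<open>4 * L / \<mu> \<le> M\<close> by (auto intro: ccontr)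
  show "out \<in> Q" using agm_run_bound(1)[OF run] assms M by blast
  \<comment> \<open>Strong convexity is used at the pair \<open>out\<close>, \<open>xstar\<close>;
    the sign of \<open>\<psi> out xstar\<close> then allows the model term to be dropped.\<close>
  then have "\<mu> * V out xstar \<le> f out - f xstar - \<psi> out xstar" "\<psi> out xstar \<ge> 0"
    using assms by (auto simp: left_rel_strongly_convex_def)
  then have "\<mu> * V out xstar \<le> f out - f xstar" by linarith
  also have "\<dots> \<le> 2 * L * V x0 xstar / M + (\<delta>' + 2 * \<delta>)"
    using agm_run_bound(2)[OF run] assms M by blast
  also have "2 * L * V x0 xstar / M \<le> \<mu> * V x0 xstar / 2"
  proof -
    have "4 * L \<le> \<mu> * M" using assms by (simp add: field_simps)
    then have "4 * L * V x0 xstar \<le> \<mu> * M * V x0 xstar"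
      using V_nonneg assms by (intro mult_right_mono) auto
    then show ?thesis using M by (simp add: field_simps)
  qed
  finally show "V out xstar \<le> V x0 xstar / 2 + (\<delta>' + 2 * \<delta>) / \<mu>"
    using \<open>0 < \<mu>\<close> by (simp add: field_simps)
qed

text \<open>The additive error is the fixed point of \<open>t \<mapsto> t / 2 + c\<close> with
  \<open>c = (\<delta>' + 2 * \<delta>) / \<mu>\<close>, namely \<open>2 * c\<close>, so the bound
  reproduces itself under each contraction.\<close>

lemma restarted_agm_bound:
  assumes run: "restarted_agm Q V \<psi> f\<^sub>\<delta> \<delta> \<delta>' prox L0 x0 p Ns xs"
    and "x0 \<in> Q" "\<And>j. 0 < L0 j \<and> L0 j \<le> 2 * L" "xstar \<in> Q"
    and "0 < \<mu>" "\<And>j. j < p \<Longrightarrow> 4 * L / \<mu> \<le> Ns j"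
    and "\<And>x. x \<in> Q \<Longrightarrow> \<psi> x xstar \<ge> 0"
    and "left_rel_strongly_convex Q V f \<psi> \<mu>"
    and "0 \<le> \<delta>" "0 \<le> \<delta>'"
  shows "V (xs p) xstar \<le> V x0 xstar / 2 ^ p + 2 * ((\<delta>' + 2 * \<delta>) / \<mu>)"
proof -
  have "xs j \<in> Q \<and> V (xs j) xstar \<le> V x0 xstar / 2 ^ j + 2 * ((\<delta>' + 2 * \<delta>) / \<mu>)" if "j \<le> p" for j
    using that
  proof (induction j)
    case 0
    then show ?case using assms by (simp add: restarted_agm_def)
  next
    case (Suc j)
    then have "agm_run Q V \<psi> f\<^sub>\<delta> \<delta> \<delta>' (prox j) (L0 j) (xs j) (Ns j) (xs (Suc j))"
      using run by (simp add: restarted_agm_def)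
    then have "xs (Suc j) \<in> Q"
      "V (xs (Suc j)) xstar \<le> V (xs j) xstar / 2 + (\<delta>' + 2 * \<delta>) / \<mu>"
      using agm_run_contraction[of "prox j" "L0 j" "xs j" "Ns j" "xs (Suc j)" xstar \<mu>] Suc assms
      by simp_all
    then show ?case using Suc by (simp add: add_divide_distrib)
  qed
  then show ?thesis by simp
qed

end

section \<open>Choice of the restart schedule\<close>

text \<open>The schedule is fixed before the oracle, so it serves every choice of inexact
  minimizers. The existence clause shows that the distance bound is not vacuous when the oracle is
  total.\<close>

theorem theorem26:
  fixes Q :: "'a::euclidean_space set"
    and d f f\<^sub>\<delta> :: "'a \<Rightarrow> real" and grad :: "'a \<Rightarrow> 'a" and \<psi> V :: "'a \<Rightarrow> 'a \<Rightarrow> real"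
    and \<delta> \<delta>' L \<mu> R \<epsilon> :: real and L0 :: "nat \<Rightarrow> real" and x0 xstar :: 'a
  assumes "convex Q"
    and "convex_on Q d"
    and "\<And>y. y \<in> Q \<Longrightarrow> (d has_derivative (\<lambda>h. grad y \<bullet> h)) (at y within Q)"
    and "V = bregman d grad"
    and "convex_on Q f"
    and "xstar \<in> Q" and "\<And>x. x \<in> Q \<Longrightarrow> f xstar \<le> f x"
    and "\<delta> \<ge> 0" and "\<delta>' \<ge> 0" and "L > 0" and "\<mu> > 0"
    and "\<And>y. y \<in> Q \<Longrightarrow> is_model Q V f \<delta> L y (f\<^sub>\<delta> y) \<psi>"
    and "\<And>x. x \<in> Q \<Longrightarrow> \<psi> x xstar \<ge> 0"
    and "left_rel_strongly_convex Q V f \<psi> \<mu>"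
    and "x0 \<in> Q" and "V x0 xstar \<le> R\<^sup>2"
    and "\<epsilon> > 0"
    and "\<And>j. 0 < L0 j \<and> L0 j \<le> L"
  shows "\<exists>p Ns.
           (\<forall>j<p. 1 \<le> Ns j) \<and>
           (\<epsilon> < R\<^sup>2 \<longrightarrow> 1 \<le> p) \<and>
           (\<Sum>j<p. Ns j) \<le> nat \<lceil>log 2 (R\<^sup>2 / \<epsilon>)\<rceil> * nat \<lceil>4 * L / \<mu>\<rceil> \<and>
           (\<forall>prox.
              (\<forall>xs. restarted_agm Q V \<psi> f\<^sub>\<delta> \<delta> \<delta>' prox L0 x0 p Ns xs \<longrightarrow>
                 V (xs p) xstar \<le> \<epsilon> + 2 * \<delta>' / \<mu> + 4 * \<delta> / \<mu>) \<and>
              (total_oracle Q V \<psi> \<delta>' prox \<longrightarrow>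
                 (\<exists>xs. restarted_agm Q V \<psi> f\<^sub>\<delta> \<delta> \<delta>' prox L0 x0 p Ns xs)))"
proof -
  interpret relative_model Q d f f\<^sub>\<delta> grad \<psi> V \<delta> \<delta>' L
    using assms by unfold_locales auto
  \<comment> \<open>All runs have the same length \<open>M\<close>, so the total
    \<open>p * M\<close> equals the claimed bound. For \<open>0 < R\<^sup>2 \<le> \<epsilon>\<close>
    the truncation by \<open>nat\<close> gives \<open>p = 0\<close>, and the starting point itself
    is close enough.\<close>
  define p where "p = nat \<lceil>log 2 (R\<^sup>2 / \<epsilon>)\<rceil>"
  define M where "M = nat \<lceil>4 * L / \<mu>\<rceil>"
  have "0 < 4 * L / \<mu>" using \<open>L > 0\<close> \<open>\<mu> > 0\<close> by simp
  then have M: "1 \<le> M" "4 * L / \<mu> \<le> real M"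
    unfolding M_def by linarith+
  have L0: "0 < L0 j \<and> L0 j \<le> 2 * L" for j
    using assms(18)[of j] \<open>L > 0\<close> by linarith
  have p: "1 \<le> p" if "\<epsilon> < R\<^sup>2"
  proof -
    have "1 < R\<^sup>2 / \<epsilon>" using that \<open>\<epsilon> > 0\<close> by simp
    then have "0 < log 2 (R\<^sup>2 / \<epsilon>)" by simp
    then show ?thesis unfolding p_def by linarith
  qed
  have "R\<^sup>2 / 2 ^ p \<le> \<epsilon>"
  \<comment> \<open>Writing the ratio as a power of 2 requires a positive argument of the
    logarithm.\<close>
  proof (cases "R = 0")
    case False
    have "R\<^sup>2 / \<epsilon> = 2 powr log 2 (R\<^sup>2 / \<epsilon>)" using False \<open>\<epsilon> > 0\<close> by simp
    also have "\<dots> \<le> 2 powr p"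
      unfolding p_def by (intro powr_mono) linarith+
    finally show ?thesis using \<open>\<epsilon> > 0\<close> by (simp add: powr_realpow field_simps)
  qed (use \<open>\<epsilon> > 0\<close> in simp)
  moreover have "V x0 xstar / 2 ^ p \<le> R\<^sup>2 / 2 ^ p"
    using assms by (simp add: divide_right_mono)
  ultimately have V0: "V x0 xstar / 2 ^ p \<le> \<epsilon>" by linarith
  have bound: "V (xs p) xstar \<le> \<epsilon> + 2 * \<delta>' / \<mu> + 4 * \<delta> / \<mu>"
    if "restarted_agm Q V \<psi> f\<^sub>\<delta> \<delta> \<delta>' prox L0 x0 p (\<lambda>_. M) xs" for prox xs
    using restarted_agm_bound[OF that, of xstar \<mu>] assms L0 M V0
    by (simp add: add_divide_distrib)
  have "\<exists>xs. restarted_agm Q V \<psi> f\<^sub>\<delta> \<delta> \<delta>' prox L0 x0 p (\<lambda>_. M) xs"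
    if "total_oracle Q V \<psi> \<delta>' prox" for prox
    using restarted_agm_exists[of x0 L0 p "\<lambda>_. M" prox] that assms L0 M by blast
  then show ?thesis
    using p M bound
    by (intro exI[of _ p] exI[of _ "\<lambda>_. M"]) (auto simp: p_def M_def)
qed

end
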